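(* Let $d,q\in\mathbb N^+$ with $q\ge 2$ and let $A=A(H(d,q))$ be the adjacency matrix of the Hamming graph $H(d,q)$. If $q\ge 3$, then no positive power of $A$ has PST between distinct vertices. If $q=2$, then PST under a positive power of $A$ can occur between distinct vertices only when they are antipodal.
   Context: $\mathbb N^+=\{1,2,3,\ldots\}$. The vertices of the Hamming graph $H(d,q)$ are the words of length $d$ over an alphabet of size $q$; two words are adjacent when their Hamming distance is one. For $q=2$, two vertices are antipodal when they are at Hamming distance $d$. A positive power of $A$ is $A^k$ with $k\in\mathbb N^+$. A real symmetric matrix $K$ indexed by a finite vertex set has perfect state transfer (PST) from vertex $a$ to vertex $b$ if $\exp(-\mathrm i\tau K)e_a=\gamma e_b$ for some $\tau>0$ and some $\gamma\in\mathbb C$ with $|\gamma|=1$, where $e_v$ is the standard basis vector indexed by $v$. *)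

theory Defs
  imports "HOL-Analysis.Analysis"
begin

text \<open>The type class operations \<open>*\<close> and \<open>^\<close> on \<^typ>\<open>'a ^ 'n ^ 'n\<close> are entrywise, so powers and
  the exponential with respect to the matrix product \<open>**\<close> are defined here.\<close>

primrec matrix_power :: "'a::semiring_1 ^ 'n ^ 'n \<Rightarrow> nat \<Rightarrow> 'a ^ 'n ^ 'n" where
  "matrix_power M 0 = mat 1"
| "matrix_power M (Suc k) = M ** matrix_power M k"

definition matrix_exp :: "complex ^ 'n ^ 'n \<Rightarrow> complex ^ 'n ^ 'n" where
  "matrix_exp M = (\<Sum>k. (1 / fact k) *\<^sub>R matrix_power M k)"

lemma summable_matrix_exp:
  fixes M :: "complex ^ 'n ^ 'n"
  shows "summable (\<lambda>k. (1 / fact k) *\<^sub>R matrix_power M k)"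
proof -
  let ?mul = "(**) :: complex ^ 'n ^ 'n \<Rightarrow> complex ^ 'n ^ 'n \<Rightarrow> complex ^ 'n ^ 'n"
  have "(X + Y) ** Z = X ** Z + Y ** Z" for X Y Z :: "complex ^ 'n ^ 'n"
    unfolding matrix_matrix_mult_def by (vector distrib_right sum.distrib)
  then have "bilinear ?mul"
    unfolding bilinear_def
    by (intro conjI allI linearI)
      (simp_all only: matrix_add_ldistrib matrix_scalar_ac flip: scalar_matrix_assoc)
  then have "bounded_bilinear ?mul"
    by (simp only: bilinear_conv_bounded_bilinear)
  from bounded_bilinear.pos_bounded[OF this]
  obtain C where C: "C > 0" "\<And>X Y. norm (?mul X Y) \<le> norm X * norm Y * C"
    by metis
  have pow: "norm (matrix_power M k) \<le> norm (mat 1 :: complex ^ 'n ^ 'n) * (norm M * C) ^ k" for k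
  proof (induction k)
    case (Suc k)
    have "norm (matrix_power M (Suc k)) \<le> (norm M * C) * norm (matrix_power M k)"
      using C(2)[of M "matrix_power M k"] by (simp add: ac_simps)
    also have "\<dots> \<le> (norm M * C) * (norm (mat 1 :: complex ^ 'n ^ 'n) * (norm M * C) ^ k)"
      using Suc C(1) by (intro mult_left_mono) auto
    finally show ?case
      by (simp add: ac_simps)
  qed simp
  show ?thesis
  proof (rule summable_comparison_test)
    show "\<exists>N. \<forall>k\<ge>N. norm ((1 / fact k) *\<^sub>R matrix_power M k)
        \<le> norm (mat 1 :: complex ^ 'n ^ 'n) * ((norm M * C) ^ k /\<^sub>R fact k)"
      using pow by (auto simp: field_simps)
    show "summable (\<lambda>k. norm (mat 1 :: complex ^ 'n ^ 'n) * ((norm M * C) ^ k /\<^sub>R fact k))"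
      by (intro summable_mult summable_exp_generic)
  qed
qed

text \<open>Perfect state transfer is a notion for symmetric \<open>K\<close>; symmetry is not part of the
  definition, and \<open>transpose_hamming_power\<close> below supplies it where it is needed.\<close>

definition perfect_state_transfer :: "real ^ 'v ^ 'v \<Rightarrow> 'v \<Rightarrow> 'v \<Rightarrow> bool" where
  "perfect_state_transfer K a b \<longleftrightarrow>
     (\<exists>\<tau>>0. \<exists>\<gamma>. cmod \<gamma> = 1 \<and>
        matrix_exp (\<chi> u v. - \<i> * complex_of_real \<tau> * complex_of_real (K $ u $ v)) *v axis a 1
          = \<gamma> *s axis b 1)"

text \<open>A word of length \<open>d\<close> over an alphabet of size \<open>q\<close> is an element of \<^typ>\<open>'q ^ 'd\<close>
  with \<open>CARD('d) = d\<close> and \<open>CARD('q) = q\<close>.\<close>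

definition hamming_distance :: "'q ^ 'd \<Rightarrow> 'q ^ 'd \<Rightarrow> nat" where
  "hamming_distance u v = card {i. u $ i \<noteq> v $ i}"

definition hamming_adjacent :: "'q ^ 'd \<Rightarrow> 'q ^ 'd \<Rightarrow> bool" where
  "hamming_adjacent u v \<longleftrightarrow> hamming_distance u v = 1"

definition antipodal :: "'q ^ 'd \<Rightarrow> 'q ^ 'd \<Rightarrow> bool" where
  "antipodal u v \<longleftrightarrow> hamming_distance u v = CARD('d)"

definition adjacency_matrix :: "('v \<Rightarrow> 'v \<Rightarrow> bool) \<Rightarrow> real ^ 'v ^ 'v" where
  "adjacency_matrix E = (\<chi> u v. if E u v then 1 else 0)"

lemma transpose_hamming_power:
  "transpose (matrix_power (adjacency_matrix (hamming_adjacent :: 'q::finite ^ 'd \<Rightarrow> _)) k)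
     = matrix_power (adjacency_matrix hamming_adjacent) k"
proof -
  let ?A = "adjacency_matrix (hamming_adjacent :: 'q ^ 'd \<Rightarrow> _)"
  have "hamming_adjacent u v \<longleftrightarrow> hamming_adjacent v u" for u v :: "'q ^ 'd"
  proof -
    have "{i. u $ i \<noteq> v $ i} = {i. v $ i \<noteq> u $ i}" by auto
    then show ?thesis unfolding hamming_adjacent_def hamming_distance_def by (simp only:)
  qed
  then have A: "transpose ?A = ?A"
    unfolding transpose_def adjacency_matrix_def by (intro vec_eq_iff[THEN iffD2] allI) auto
  have comm: "matrix_power ?A k ** ?A = ?A ** matrix_power ?A k" for k
    by (induction k) (simp_all add: matrix_mul_assoc[symmetric])
  show ?thesis
    by (induction k) (simp_all add: matrix_transpose_mul A comm)
qed

end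

theory Submission
  imports Defs
begin

text \<open>An automorphism of the graph preserves the entries of every power of \<open>A\<close> and hence those of
  \<open>exp (- \<i> \<tau> A ^ k)\<close>. So under perfect state transfer from \<open>a\<close> to \<open>b\<close>, every automorphism fixing
  \<open>a\<close> fixes \<open>b\<close>. In a Hamming graph with \<open>a \<noteq> b\<close> this fails if \<open>q \<ge> 3\<close> (swap \<open>b\<^sub>i \<noteq> a\<^sub>i\<close> with a
  third letter in position \<open>i\<close>), and if \<open>a\<close>, \<open>b\<close> differ in position \<open>i\<close> but agree in position \<open>j\<close>
  (swap the two positions, relabelling the letters so that \<open>a\<close> is fixed).\<close>

text \<open>For bijective \<open>\<sigma>\<close> this says that \<open>M\<close> commutes with the
  permutation matrix of \<open>\<sigma>\<close>.\<close>

definition matrix_invariant :: "('v \<Rightarrow> 'v) \<Rightarrow> 'a ^ 'v ^ 'v \<Rightarrow> bool" where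
  "matrix_invariant \<sigma> M \<longleftrightarrow> (\<forall>u v. M $ \<sigma> u $ \<sigma> v = M $ u $ v)"

lemma matrix_invariant_matrix_power:
  fixes M :: "'a::semiring_1 ^ 'v ^ 'v"
  assumes "bij \<sigma>" "matrix_invariant \<sigma> M"
  shows "matrix_invariant \<sigma> (matrix_power M k)"
proof (induction k)
  case 0
  show ?case
    using bij_is_inj[OF assms(1)] by (auto simp: matrix_invariant_def mat_def inj_eq)
next
  case (Suc k)
  \<comment> \<open>As \<open>w\<close> runs over all indices, so does \<open>\<sigma> w\<close>;
    then invariance applies to both factors.\<close>
  have "(\<Sum>w\<in>UNIV. M $ \<sigma> u $ w * matrix_power M k $ w $ \<sigma> v)
      = (\<Sum>w\<in>UNIV. M $ \<sigma> u $ \<sigma> w * matrix_power M k $ \<sigma> w $ \<sigma> v)" for u v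
    by (rule sum.reindex_bij_betw[symmetric]) (rule assms(1))
  with Suc assms(2) show ?case
    by (simp add: matrix_invariant_def matrix_matrix_mult_def)
qed

lemma matrix_exp_nth:
  fixes M :: "complex ^ 'n ^ 'n"
  shows "matrix_exp M $ u $ v = (\<Sum>k. (1 / fact k) *\<^sub>R (matrix_power M k $ u $ v))"
proof -
  have "bounded_linear (\<lambda>X :: complex ^ 'n ^ 'n. X $ u $ v)"
    using bounded_linear_compose[OF bounded_linear_vec_nth bounded_linear_vec_nth] .
  from bounded_linear.suminf[OF this summable_matrix_exp[of M]] show ?thesis
    by (simp add: matrix_exp_def)
qed

lemma matrix_invariant_matrix_exp:
  assumes "bij \<sigma>" "matrix_invariant \<sigma> M"
  shows "matrix_invariant \<sigma> (matrix_exp M)"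
  using matrix_invariant_matrix_power[OF assms]
  by (simp add: matrix_invariant_def matrix_exp_nth)

text \<open>Column \<open>a\<close> of the exponential \<open>U\<close> is \<open>\<gamma>\<close>
  times the basis vector at \<open>b\<close>, so its only nonzero entry is in row \<open>b\<close>.
  Since \<open>\<sigma>\<close> fixes \<open>a\<close>, the entry in row \<open>\<sigma> b\<close>
  equals the one in row \<open>b\<close>, which is nonzero; hence the rows coincide.\<close>

lemma perfect_state_transfer_fixed:
  assumes "perfect_state_transfer K a b" "bij \<sigma>" "matrix_invariant \<sigma> K" "\<sigma> a = a"
  shows "\<sigma> b = b"
proof -
  obtain \<tau> \<gamma> where \<gamma>: "cmod \<gamma> = 1"
    and transfer: "matrix_exp (\<chi> u v. - \<i> * complex_of_real \<tau> * complex_of_real (K $ u $ v))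
      *v axis a 1 = \<gamma> *s axis b 1"
    using assms(1) unfolding perfect_state_transfer_def by blast
  define U where "U = matrix_exp (\<chi> u v. - \<i> * complex_of_real \<tau> * complex_of_real (K $ u $ v))"
  have "matrix_invariant \<sigma> U"
    unfolding U_def using assms(2,3)
    by (intro matrix_invariant_matrix_exp) (simp_all add: matrix_invariant_def)
  then have "U $ \<sigma> b $ a = U $ b $ a"
    using assms(4) by (metis matrix_invariant_def)
  moreover have "U $ u $ a = (if u = b then \<gamma> else 0)" for u
  proof -
    have "U $ u $ a = (U *v axis a 1) $ u"
      by (simp add: matrix_vector_mult_def axis_def if_distrib[of "(*) _"] cong: if_cong)
    then show ?thesis
      using transfer by (simp add: U_def axis_def)
  qed
  ultimately show ?thesis
    using \<gamma> by (auto split: if_splits)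
qed

lemma hamming_distance_eq_0_iff:
  fixes u v :: "'q ^ 'd"
  shows "hamming_distance u v = 0 \<longleftrightarrow> u = v"
  by (simp add: hamming_distance_def vec_eq_iff)

text \<open>Injective relabelling keeps unequal letters unequal, so \<open>p\<close> maps the
  positions where the new words differ bijectively onto those where \<open>u\<close> and
  \<open>v\<close> differ.\<close>

lemma hamming_distance_permute_relabel:
  fixes u v :: "'q ^ 'd"
  assumes "bij p" "\<And>i. inj (f i)"
  shows "hamming_distance (\<chi> i. f i (u $ p i)) (\<chi> i. f i (v $ p i)) = hamming_distance u v"
proof -
  have "p ` {i. u $ p i \<noteq> v $ p i} = {i. u $ i \<noteq> v $ i}"
    using bij_is_surj[OF assms(1)] by auto
  then have "bij_betw p {i. u $ p i \<noteq> v $ p i} {i. u $ i \<noteq> v $ i}"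
    using bij_betw_subset[OF assms(1)] by blast
  then show ?thesis
    by (simp add: hamming_distance_def inj_eq[OF assms(2)] bij_betw_same_card)
qed

text \<open>Isometries are injective, since distance zero means equality, and so bijective on the
  finite set of words; they preserve adjacency.\<close>

lemma hamming_isometry_fixed:
  fixes a b :: "'q::finite ^ 'd::finite"
  assumes "perfect_state_transfer (matrix_power (adjacency_matrix hamming_adjacent) k) a b"
    and isometry: "\<And>u v. hamming_distance (\<sigma> u) (\<sigma> v) = hamming_distance u v"
    and "\<sigma> a = a"
  shows "\<sigma> b = b"
proof -
  have "inj \<sigma>"
    by (rule injI) (metis isometry hamming_distance_eq_0_iff)
  then have "bij \<sigma>"
    by (simp add: bij_def finite_UNIV_inj_surj)
  moreover have "matrix_invariant \<sigma> (adjacency_matrix hamming_adjacent :: real ^ _ ^ _)"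
    by (simp add: matrix_invariant_def adjacency_matrix_def hamming_adjacent_def isometry)
  ultimately show ?thesis
    using assms(1,3) by (blast intro: perfect_state_transfer_fixed matrix_invariant_matrix_power)
qed

lemma hamming_transfer_antipodal:
  fixes a b :: "'q::finite ^ 'd::finite"
  assumes "perfect_state_transfer (matrix_power (adjacency_matrix hamming_adjacent) k) a b"
    and "a \<noteq> b"
  shows "antipodal a b"
proof (rule ccontr)
  assume "\<not> antipodal a b"
  then have "{i. a $ i \<noteq> b $ i} \<noteq> UNIV"
    unfolding antipodal_def hamming_distance_def by metis
  then obtain j where j: "a $ j = b $ j" by blast
  obtain i where i: "a $ i \<noteq> b $ i"
    using assms(2) by (auto simp: vec_eq_iff)
  \<comment> \<open>Exchanging positions \<open>i\<close> and \<open>j\<close> puts the letter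
    \<open>a $ j\<close> at \<open>i\<close> and \<open>a $ i\<close> at \<open>j\<close>; swapping
    these two letters at both positions restores \<open>a\<close>.\<close>
  define f where "f l = (if l = i \<or> l = j then Transposition.transpose (a $ i) (a $ j) else id)" for l
  define \<sigma> where "\<sigma> x = (\<chi> l. f l (x $ Transposition.transpose i j l))" for x :: "'q ^ 'd"
  have "hamming_distance (\<sigma> u) (\<sigma> v) = hamming_distance u v" for u v
    unfolding \<sigma>_def by (rule hamming_distance_permute_relabel) (simp_all add: f_def)
  moreover have "\<sigma> a = a"
    by (auto simp: vec_eq_iff \<sigma>_def f_def Transposition.transpose_def)
  ultimately have "\<sigma> b = b"
    by (rule hamming_isometry_fixed[OF assms(1)])
  then have "\<sigma> b $ j = b $ j"
    by simp
  \<comment> \<open>The letter of \<open>\<sigma> b\<close> at \<open>j\<close> comes from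
    \<open>b $ i\<close>, while \<open>b $ j = a $ j\<close>. Undoing the transposition gives
    \<open>b $ i = a $ i\<close>.\<close>
  then have "Transposition.transpose (a $ i) (a $ j) (b $ i) = a $ j"
    by (simp add: \<sigma>_def f_def j)
  then show False
    using i by (auto simp: transpose_eq_iff)
qed

lemma hamming_no_transfer:
  fixes a b :: "'q::finite ^ 'd::finite"
  assumes "CARD('q) \<ge> 3"
    and "perfect_state_transfer (matrix_power (adjacency_matrix hamming_adjacent) k) a b"
  shows "a = b"
proof (rule ccontr)
  assume "a \<noteq> b"
  then obtain i where i: "a $ i \<noteq> b $ i"
    by (auto simp: vec_eq_iff)
  have "card {a $ i, b $ i} \<le> 2"
    by (simp add: card_insert_if)
  then have "{a $ i, b $ i} \<noteq> UNIV"
    using assms(1) by auto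
  then obtain c where c: "c \<noteq> a $ i" "c \<noteq> b $ i"
    by blast
  \<comment> \<open>Both swapped letters differ from \<open>a $ i\<close>, so \<open>a\<close> stays
    fixed, but \<open>b $ i\<close> becomes \<open>c\<close>.\<close>
  define f where "f l = (if l = i then Transposition.transpose (b $ i) c else id)" for l
  define \<sigma> where "\<sigma> x = (\<chi> l. f l (x $ id l))" for x :: "'q ^ 'd"
  have "hamming_distance (\<sigma> u) (\<sigma> v) = hamming_distance u v" for u v
    unfolding \<sigma>_def by (rule hamming_distance_permute_relabel[OF bij_id]) (simp add: f_def)
  moreover have "\<sigma> a = a"
    using i c by (auto simp: vec_eq_iff \<sigma>_def f_def Transposition.transpose_def)
  ultimately have "\<sigma> b = b"
    by (rule hamming_isometry_fixed[OF assms(2)])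
  then have "\<sigma> b $ i = b $ i"
    by simp
  then show False
    using c by (simp add: \<sigma>_def f_def)
qed

theorem proposition5p2:
  fixes A :: "real ^ ('q::finite ^ 'd::finite) ^ ('q ^ 'd)"
  assumes "CARD('q) \<ge> 2"
    and "A = adjacency_matrix hamming_adjacent"
  shows "(CARD('q) \<ge> 3 \<longrightarrow>
            \<not> (\<exists>k\<ge>1. \<exists>a b. a \<noteq> b \<and> perfect_state_transfer (matrix_power A k) a b))
       \<and> (CARD('q) = 2 \<longrightarrow>
            (\<forall>k\<ge>1. \<forall>a b. a \<noteq> b \<and> perfect_state_transfer (matrix_power A k) a b \<longrightarrow> antipodal a b))"
  unfolding assms(2) using hamming_no_transfer hamming_transfer_antipodal by blast

end
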